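(* Let $K\ge 1$, $J\ge 0$, $\tilde K=K+J$, and let $M_j,d_j$ ($1\le j\le\tilde K$) and $N_k$ ($1\le k\le K$) be positive integers. For $k\in\{1,\dots,K\}$ and $j\in\{1,\dots,\tilde K\}$ let $\mathbf H_{kj}\in\mathbb C^{N_k\times M_j}$ be random matrices, all of whose entries (over all $k,j$) are independent random variables drawn from continuous distributions. Let $\mathcal A\subseteq\{(k,j): 1\le k\le K,\ 1\le j\le \tilde K,\ k\ne j\}$. Suppose there are proper alignment subsets $\mathcal A^{(r)}(k)$ ($1\le k\le K$) and $\mathcal A^{(t)}(j)$ ($1\le j\le\tilde K$) such that $$\mathcal A=\Big(\bigcup_{k=1}^{K}\mathcal A^{(r)}(k)\Big)\cup\Big(\bigcup_{j=1}^{\tilde K}\mathcal A^{(t)}(j)\Big).$$ Then, almost surely, the GIA transceiver design problem with alignment set $\mathcal A$ is feasible, i.e. there exist matrices $\mathbf U_k\in\mathbb C^{N_k\times d_k}$ ($1\le k\le K$) and $\mathbf V_j\in\mathbb C^{M_j\times d_j}$ ($1\le j\le\tilde K$) such that $$\mathrm{rank}(\mathbf U_k^{\mathrm H}\mathbf H_{kk}\mathbf V_k)=d_k\ \ (1\le k\le K),\qquad \mathrm{rank}(\mathbf V_j)=d_j\ \ (K+1\le j\le\tilde K),$$ $$\mathbf U_k^{\mathrm H}\mathbf H_{kj}\mathbf V_j=\mathbf 0\quad\text{for all }(k,j)\in\mathcal A .$$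
   Context: $(\cdot)^{\mathrm H}$ denotes the Hermitian (conjugate) transpose. The indices $1,\dots,K$ label legitimate transmitter/receiver pairs and $K+1,\dots,K+J$ label legitimate jammers; transmitter or jammer $j$ has $M_j$ antennas and sends $d_j$ streams, receiver $k$ has $N_k$ antennas. "Drawn from a continuous distribution" means that the distribution has no atoms (e.g. it has a density). Proper alignment subsets: a set $\mathcal A^{(r)}(k)\subseteq\{k\}\times(\{1,\dots,\tilde K\}\setminus\{k\})$ and a set $\mathcal A^{(t)}(j)\subseteq(\{1,\dots,K\}\setminus\{j\})\times\{j\}$ are called proper if and only if, respectively, $$\sum_{j:(k,j)\in\mathcal A^{(r)}(k)}d_j\le N_k-d_k,\qquad \sum_{k:(k,j)\in\mathcal A^{(t)}(j)}d_k\le M_j-d_j ,$$ where an empty sum equals $0$ (so that properness of all the subsets entails $d_k\le N_k$ and $d_j\le M_j$). *)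

theory Defs
  imports "HOL-Probability.Probability" "Jordan_Normal_Form.Schur_Decomposition"
    "Jordan_Normal_Form.DL_Rank"
begin

text \<open>
  Legitimate pairs are indexed by \<open>{1..K}\<close> and legitimate jammers by \<open>{K+1..K+J}\<close>.  Only the
  values of \<open>M\<close>, \<open>N\<close>, \<open>d\<close>, \<open>H\<close> at these indices matter.
  The pair \<open>(k, j)\<close> stands for the link from transmitter or jammer \<open>j\<close> to receiver \<open>k\<close>.
\<close>

(* "Drawn from a continuous distribution": the law has no atoms. *)
definition continuous_distribution :: "'a measure \<Rightarrow> bool" where
  "continuous_distribution D \<longleftrightarrow> (\<forall>x\<in>space D. emeasure D {x} = 0)"

(* The differences on the right-hand sides are integer differences: truncated subtraction on nat
   would lose the consequences d k \<le> N k and d j \<le> M j of properness. *)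
definition proper_rx_subset ::
    "nat \<Rightarrow> nat \<Rightarrow> (nat \<Rightarrow> nat) \<Rightarrow> (nat \<Rightarrow> nat) \<Rightarrow> nat \<Rightarrow> (nat \<times> nat) set \<Rightarrow> bool" where
  "proper_rx_subset K J N d k S \<longleftrightarrow>
     S \<subseteq> {k} \<times> ({1..K+J} - {k}) \<and>
     int (\<Sum>j | (k, j) \<in> S. d j) \<le> int (N k) - int (d k)"

definition proper_tx_subset ::
    "nat \<Rightarrow> (nat \<Rightarrow> nat) \<Rightarrow> (nat \<Rightarrow> nat) \<Rightarrow> nat \<Rightarrow> (nat \<times> nat) set \<Rightarrow> bool" where
  "proper_tx_subset K M d j S \<longleftrightarrow>
     S \<subseteq> ({1..K} - {j}) \<times> {j} \<and>
     int (\<Sum>k | (k, j) \<in> S. d k) \<le> int (M j) - int (d j)"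

(* The first argument of vec_space.rank is the number of rows of the matrix. *)
definition gia_feasible ::
    "nat \<Rightarrow> nat \<Rightarrow> (nat \<Rightarrow> nat) \<Rightarrow> (nat \<Rightarrow> nat) \<Rightarrow> (nat \<Rightarrow> nat) \<Rightarrow>
     (nat \<Rightarrow> nat \<Rightarrow> complex mat) \<Rightarrow> (nat \<times> nat) set \<Rightarrow> bool" where
  "gia_feasible K J M N d H A \<longleftrightarrow>
     (\<exists>U V :: nat \<Rightarrow> complex mat.
        (\<forall>k\<in>{1..K}. U k \<in> carrier_mat (N k) (d k)) \<and>
        (\<forall>j\<in>{1..K+J}. V j \<in> carrier_mat (M j) (d j)) \<and>
        (\<forall>k\<in>{1..K}. vec_space.rank (d k) (mat_adjoint (U k) * H k k * V k) = d k) \<and>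
        (\<forall>j\<in>{K+1..K+J}. vec_space.rank (M j) (V j) = d j) \<and>
        (\<forall>(k, j)\<in>A. mat_adjoint (U k) * H k j * V j = 0\<^sub>m (d k) (d j)))"

end

(* Algebraically independent tuples of complex numbers are indistinguishable by polynomial equations
   with rational coefficients, so solvability of such a system at one algebraically independent
   parameter tuple implies solvability at every other one: the isomorphism between the two
   generated rings extends step by step to a ring containing the solution, because the complex
   field is algebraically closed and uncountable. The channel entries are almost surely
   algebraically independent, as each nonzero integer polynomial vanishes on a null set of any
   product of atomless laws. It therefore suffices to solve the alignment equations on some
   nonempty open set of channels, since such a set contains an algebraically independent tuple.
   Normalising U^H and V to contain an identity block leaves, by properness, enough free entries
   to pair each alignment equation with an unknown of its own, and near a channel of zeros and ones the equations become a
   fixed-point problem for a contraction. *)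
theory Submission
  imports Defs "Jordan_Normal_Form.DL_Rank_Submatrix"
begin

section \<open>Corresponding subrings of the complex numbers\<close>

text \<open>The graph of an isomorphism between two subrings of the complex numbers: applied to
  differences, the zero condition makes the relation single-valued and injective.\<close>

definition ring_corr :: "(complex \<times> complex) set \<Rightarrow> bool" where
  "ring_corr G \<longleftrightarrow> (1, 1) \<in> G \<and>
     (\<forall>x y x' y'. (x, y) \<in> G \<longrightarrow> (x', y') \<in> G \<longrightarrow>
        (x - x', y - y') \<in> G \<and> (x * x', y * y') \<in> G) \<and>
     (\<forall>x y. (x, y) \<in> G \<longrightarrow> (x = 0 \<longleftrightarrow> y = 0))"

definition poly_corr :: "(complex \<times> complex) set \<Rightarrow> complex poly \<Rightarrow> complex poly \<Rightarrow> bool" where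
  "poly_corr G p q \<longleftrightarrow> (\<forall>i. (coeff p i, coeff q i) \<in> G)"

lemma countable_polys:
  assumes "countable S" shows "countable {p :: complex poly. \<forall>i. coeff p i \<in> S}"
proof -
  have "p \<in> Poly ` lists S" if "\<forall>i. coeff p i \<in> S" for p :: "complex poly"
  proof
    show "p = Poly (coeffs p)" by simp
    show "coeffs p \<in> lists S" using that unfolding coeffs_def by auto
  qed
  then have "{p. \<forall>i. coeff p i \<in> S} \<subseteq> Poly ` lists S" by blast
  then show ?thesis by (rule countable_subset) (intro countable_image countable_lists assms)
qed

section \<open>Arithmetic of corresponding numbers and polynomials\<close>

context
  fixes G assumes G: "ring_corr G"
begin

lemma ring_corr_one: "(1, 1) \<in> G"
  and ring_corr_diff: "(x, y) \<in> G \<Longrightarrow> (x', y') \<in> G \<Longrightarrow> (x - x', y - y') \<in> G"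
  and ring_corr_mult: "(x, y) \<in> G \<Longrightarrow> (x', y') \<in> G \<Longrightarrow> (x * x', y * y') \<in> G"
  and ring_corr_zero_iff: "(x, y) \<in> G \<Longrightarrow> x = 0 \<longleftrightarrow> y = 0"
  using G unfolding ring_corr_def by blast+

lemma ring_corr_zero: "(0, 0) \<in> G"
  using ring_corr_diff[OF ring_corr_one ring_corr_one] by simp

lemma ring_corr_minus: "(x, y) \<in> G \<Longrightarrow> (- x, - y) \<in> G"
  using ring_corr_diff[OF ring_corr_zero] by force

lemma ring_corr_add: "(x, y) \<in> G \<Longrightarrow> (x', y') \<in> G \<Longrightarrow> (x + x', y + y') \<in> G"
  using ring_corr_diff[OF _ ring_corr_minus, of x y x' y'] by simp

lemma ring_corr_sum:
  "(\<And>i. i \<in> I \<Longrightarrow> (f i, g i) \<in> G) \<Longrightarrow> (sum f I, sum g I) \<in> G"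
  by (induction I rule: infinite_finite_induct) (auto intro: ring_corr_zero ring_corr_add)

lemma ring_corr_prod:
  "(\<And>i. i \<in> I \<Longrightarrow> (f i, g i) \<in> G) \<Longrightarrow> (prod f I, prod g I) \<in> G"
  by (induction I rule: infinite_finite_induct) (auto intro: ring_corr_one ring_corr_mult)

lemma poly_corr_zero_iff: "poly_corr G p q \<Longrightarrow> p = 0 \<longleftrightarrow> q = 0"
  unfolding poly_corr_def using ring_corr_zero_iff by (auto simp: poly_eq_iff)

lemma poly_corr_degree:
  assumes "poly_corr G p q" shows "degree p = degree q"
proof -
  have "coeff p i = 0 \<longleftrightarrow> coeff q i = 0" for i
    using assms ring_corr_zero_iff unfolding poly_corr_def by blast
  then show ?thesis unfolding degree_def by simp
qed

lemma poly_corr_diff: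
  "poly_corr G p q \<Longrightarrow> poly_corr G p' q' \<Longrightarrow> poly_corr G (p - p') (q - q')"
  unfolding poly_corr_def by (simp add: ring_corr_diff)

lemma poly_corr_add:
  "poly_corr G p q \<Longrightarrow> poly_corr G p' q' \<Longrightarrow> poly_corr G (p + p') (q + q')"
  unfolding poly_corr_def by (simp add: ring_corr_add)

lemma poly_corr_mult:
  "poly_corr G p q \<Longrightarrow> poly_corr G p' q' \<Longrightarrow> poly_corr G (p * p') (q * q')"
  unfolding poly_corr_def coeff_mult by (auto intro!: ring_corr_sum ring_corr_mult)

lemma poly_corr_monom: "(x, y) \<in> G \<Longrightarrow> poly_corr G (monom x n) (monom y n)"
  unfolding poly_corr_def by (auto intro: ring_corr_zero)

lemma poly_corr_smult:
  "(x, y) \<in> G \<Longrightarrow> poly_corr G p q \<Longrightarrow> poly_corr G (Polynomial.smult x p) (Polynomial.smult y q)"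
  unfolding poly_corr_def by (auto intro: ring_corr_mult)

section \<open>Pseudo-division and the adjunction of a new pair\<close>

text \<open>Leading coefficients may fail to be invertible in the rings, so each elimination step
  multiplies by one instead of dividing. The same ring operations run on both sides, which keeps
  multipliers, quotients and remainders matched.\<close>

lemma poly_corr_pseudo_div:
  assumes p0: "poly_corr G p0 q0" "p0 \<noteq> 0" and p: "poly_corr G p q"
  shows "\<exists>c c' s s' r r'. (c, c') \<in> G \<and> c \<noteq> 0 \<and> poly_corr G s s' \<and> poly_corr G r r' \<and>
    Polynomial.smult c p = s * p0 + r \<and> Polynomial.smult c' q = s' * q0 + r' \<and> (r = 0 \<or> degree r < degree p0)"
  using p
proof (induction "degree p" arbitrary: p q rule: less_induct)
  case less
  note pq = less.prems
  show ?case
  proof (cases "p = 0 \<or> degree p < degree p0")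
    case True
    have "(1, 1) \<in> G" "(1::complex) \<noteq> 0" "poly_corr G 0 0" "Polynomial.smult 1 p = 0 * p0 + p"
      "Polynomial.smult 1 q = 0 * q0 + q"
      using ring_corr_one ring_corr_zero by (auto simp: poly_corr_def)
    with True pq show ?thesis by blast
  next
    case False
    then have pne: "p \<noteq> 0" and dge: "degree p0 \<le> degree p" by auto
    have dq: "degree q = degree p" "degree q0 = degree p0"
      using poly_corr_degree pq p0 by auto
    define a where "a = lead_coeff p0"
    define a' where "a' = lead_coeff q0"
    define m where "m = monom (lead_coeff p) (degree p - degree p0)"
    define m' where "m' = monom (lead_coeff q) (degree p - degree p0)"
    have aG: "(a, a') \<in> G" using p0 dq unfolding a_def a'_def poly_corr_def by simp
    have a0: "a \<noteq> 0" using p0(2) by (simp add: a_def)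
    have mG: "poly_corr G m m'" unfolding m_def m'_def
      using pq dq by (intro poly_corr_monom) (simp add: poly_corr_def)
    \<comment> \<open>The cross-multiplied leading terms cancel, so the degree drops; the right side
      undergoes the matching step.\<close>
    define p1 where "p1 = Polynomial.smult a p - m * p0"
    define q1 where "q1 = Polynomial.smult a' q - m' * q0"
    have p1G: "poly_corr G p1 q1" unfolding p1_def q1_def
      using aG mG pq p0 by (intro poly_corr_diff poly_corr_smult poly_corr_mult)
    show ?thesis
    proof (cases "p1 = 0")
      case True
      then have "q1 = 0" using poly_corr_zero_iff[OF p1G] by simp
      with True have "Polynomial.smult a p = m * p0 + 0" "Polynomial.smult a' q = m' * q0 + 0"
        by (auto simp: p1_def q1_def)
      moreover have "poly_corr G 0 0" using ring_corr_zero by (simp add: poly_corr_def)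
      ultimately show ?thesis using aG a0 mG by blast
    next
      case False
      have degm: "degree (m * p0) = degree p"
        using pne p0(2) dge by (simp add: m_def degree_mult_eq monom_eq_0_iff degree_monom_eq)
      have lead: "coeff (m * p0) (degree p) = coeff (Polynomial.smult a p) (degree p)"
        using degm lead_coeff_mult[of m p0] pne by (simp add: a_def m_def degree_monom_eq)
      have "degree p1 < degree p"
      proof (rule ccontr)
        assume c: "\<not> degree p1 < degree p"
        have "degree p1 \<le> degree p" unfolding p1_def using degm
          by (intro degree_diff_le) auto
        with c have "degree p1 = degree p" by simp
        moreover have "coeff p1 (degree p) = 0" using lead by (simp add: p1_def)
        ultimately show False using False leading_coeff_0_iff by metis
      qed
      from less.hyps[OF this p1G] obtain c c' s s' r r' where
        *: "(c, c') \<in> G" "c \<noteq> 0" "poly_corr G s s'" "poly_corr G r r'"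
        "Polynomial.smult c p1 = s * p0 + r" "Polynomial.smult c' q1 = s' * q0 + r'" "r = 0 \<or> degree r < degree p0"
        by blast
      have "Polynomial.smult (c * a) p = (s + Polynomial.smult c m) * p0 + r"
        using *(5) by (simp add: p1_def algebra_simps smult_diff_right)
      moreover have "Polynomial.smult (c' * a') q = (s' + Polynomial.smult c' m') * q0 + r'"
        using *(6) by (simp add: q1_def algebra_simps smult_diff_right)
      moreover have "(c * a, c' * a') \<in> G" "c * a \<noteq> 0" using * aG a0 by (auto intro: ring_corr_mult)
      moreover have "poly_corr G (s + Polynomial.smult c m) (s' + Polynomial.smult c' m')"
        using * mG by (intro poly_corr_add poly_corr_smult)
      ultimately show ?thesis using * by blast
    qed
  qed
qed

text \<open>If \<open>x\<close> is algebraic over the left ring, then \<open>y\<close> is a root of the counterpart of a minimal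
  polynomial of \<open>x\<close>; otherwise \<open>y\<close> is any number transcendental over the countable right ring.\<close>

lemma ring_corr_extend_root:
  assumes "countable G"
  obtains y where "\<And>p q. poly_corr G p q \<Longrightarrow> poly p x = 0 \<longleftrightarrow> poly q y = 0"
proof (cases "\<exists>p q. poly_corr G p q \<and> p \<noteq> 0 \<and> poly p x = 0")
  case False
  define R where "R = {q :: complex poly. \<forall>i. coeff q i \<in> snd ` G}"
  have "countable R" unfolding R_def using assms by (intro countable_polys) simp
  then have "countable (\<Union>q\<in>R - {0}. {y. poly q y = 0})"
    by (intro countable_UN) (auto intro: countable_finite poly_roots_finite)
  then obtain y where y: "y \<notin> (\<Union>q\<in>R - {0}. {y. poly q y = 0})"
    using uncountable_UNIV_complex by (metis UNIV_eq_I)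
  have "poly p x = 0 \<longleftrightarrow> poly q y = 0" if pq: "poly_corr G p q" for p q
  proof -
    have "q \<in> R" using pq unfolding R_def poly_corr_def by force
    then show ?thesis using False y pq poly_corr_zero_iff[OF pq] by auto
  qed
  then show ?thesis using that by blast
next
  case True
  have minimal: "\<exists>p q. poly_corr G p q \<and> Q p q \<and> (\<forall>p' q'. poly_corr G p' q' \<and> Q p' q' \<longrightarrow> degree p \<le> degree p')"
    if "\<exists>p q. poly_corr G p q \<and> Q p q" for Q
    using ex_has_least_nat[of "\<lambda>(p, q). poly_corr G p q \<and> Q p q" _ "\<lambda>(p, q). degree p"] that by auto
  obtain p0 q0 where p0: "poly_corr G p0 q0" "p0 \<noteq> 0" "poly p0 x = 0"
    and min0: "\<And>p q. poly_corr G p q \<Longrightarrow> p \<noteq> 0 \<Longrightarrow> poly p x = 0 \<Longrightarrow> degree p0 \<le> degree p"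
    using minimal[of "\<lambda>p q. p \<noteq> 0 \<and> poly p x = 0"] True by blast
  have q0: "q0 \<noteq> 0" using p0 poly_corr_zero_iff by blast
  have "degree p0 \<noteq> 0"
  proof
    assume "degree p0 = 0"
    then obtain c where "p0 = [:c:]" by (metis degree_eq_zeroE)
    with p0 show False by simp
  qed
  then have "degree q0 \<noteq> 0" using poly_corr_degree[OF p0(1)] by simp
  then obtain y where y: "poly q0 y = 0"
    using fundamental_theorem_of_algebra constant_degree by metis
  obtain p1 q1 where p1: "poly_corr G p1 q1" "q1 \<noteq> 0" "poly q1 y = 0"
    and min1: "\<And>p q. poly_corr G p q \<Longrightarrow> q \<noteq> 0 \<Longrightarrow> poly q y = 0 \<Longrightarrow> degree p1 \<le> degree p"
    using minimal[of "\<lambda>p q. q \<noteq> 0 \<and> poly q y = 0"] p0(1) q0 y by blast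
  have p1ne: "p1 \<noteq> 0" using p1 poly_corr_zero_iff by blast
  \<comment> \<open>\<open>q0\<close> has to be minimal for \<open>y\<close> too. On division by
    \<open>p1\<close> the right remainder vanishes at \<open>y\<close>, hence is zero by minimality,
    so \<open>p0\<close> is \<open>s * p1\<close> up to the factor \<open>c\<close>. Since
    \<open>s\<close> has smaller degree than \<open>p0\<close>, it does not vanish at
    \<open>x\<close>, and therefore \<open>p1\<close> does.\<close>
  have "degree p0 \<le> degree p1"
  proof -
    obtain c c' s s' r r' where *: "(c, c') \<in> G" "c \<noteq> 0" "poly_corr G s s'" "poly_corr G r r'"
      "Polynomial.smult c p0 = s * p1 + r" "Polynomial.smult c' q0 = s' * q1 + r'" "r = 0 \<or> degree r < degree p1"
      using poly_corr_pseudo_div[OF p1(1) p1ne p0(1)] by blast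
    have "poly r' y = 0" using arg_cong[OF *(6), of "\<lambda>f. poly f y"] y p1 by simp
    then have "r' = 0" using min1[OF *(4)] *(7) poly_corr_zero_iff[OF *(4)] by force
    then have "r = 0" using poly_corr_zero_iff[OF *(4)] by simp
    then have eq: "Polynomial.smult c p0 = s * p1" using * by simp
    then have "s \<noteq> 0" using * p0 by auto
    then have deg: "degree p0 = degree s + degree p1"
      using eq *(2) p1ne degree_mult_eq[of s p1] by (metis degree_smult_eq)
    have "degree p1 \<noteq> 0"
    proof
      assume "degree p1 = 0"
      then have "degree q1 = 0" using poly_corr_degree[OF p1(1)] by simp
      then obtain c where "q1 = [:c:]" by (metis degree_eq_zeroE)
      with p1 show False by simp
    qed
    with deg have "poly s x \<noteq> 0" using min0[OF *(3) \<open>s \<noteq> 0\<close>] by auto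
    moreover have "poly s x * poly p1 x = 0"
      using arg_cong[OF eq, of "\<lambda>f. poly f x"] p0 by simp
    ultimately show ?thesis using min0[OF p1(1) p1ne] by simp
  qed
  then have min2: "\<And>p q. poly_corr G p q \<Longrightarrow> q \<noteq> 0 \<Longrightarrow> poly q y = 0 \<Longrightarrow> degree p0 \<le> degree p"
    using min1 by force
  \<comment> \<open>Modulo \<open>p0\<close> and \<open>q0\<close> only the remainders matter; their
    degree lies below the minimum, so they vanish at \<open>x\<close> or \<open>y\<close> only by
    being zero.\<close>
  have "poly p x = 0 \<longleftrightarrow> poly q y = 0" if pq: "poly_corr G p q" for p q
  proof -
    obtain c c' s s' r r' where *: "(c, c') \<in> G" "c \<noteq> 0" "poly_corr G s s'" "poly_corr G r r'"
      "Polynomial.smult c p = s * p0 + r" "Polynomial.smult c' q = s' * q0 + r'" "r = 0 \<or> degree r < degree p0"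
      using poly_corr_pseudo_div[OF p0(1,2) pq] by blast
    have c': "c' \<noteq> 0" using * ring_corr_zero_iff by blast
    have "c * poly p x = poly r x" "c' * poly q y = poly r' y"
      using arg_cong[OF *(5), of "\<lambda>f. poly f x"] arg_cong[OF *(6), of "\<lambda>f. poly f y"] p0 y by auto
    moreover have "poly r x = 0 \<longleftrightarrow> r = 0" using min0[OF *(4)] *(7) by force
    moreover have "poly r' y = 0 \<longleftrightarrow> r' = 0"
      using min2[OF *(4)] *(7) poly_corr_zero_iff[OF *(4)] by force
    ultimately show ?thesis using poly_corr_zero_iff[OF *(4)] *(2) c'
      by (metis mult_eq_0_iff)
  qed
  then show ?thesis using that by blast
qed

text \<open>The new correspondence consists of the values at \<open>x\<close> and \<open>y\<close>
  of matching polynomials. Its zero condition is what the choice of \<open>y\<close> provides, and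
  over a countable ring there are only countably many polynomials.\<close>

lemma ring_corr_extend:
  assumes "countable G"
  obtains G' y where "ring_corr G'" "countable G'" "G \<subseteq> G'" "(x, y) \<in> G'"
proof -
  obtain y where y: "\<And>p q. poly_corr G p q \<Longrightarrow> poly p x = 0 \<longleftrightarrow> poly q y = 0"
    by (rule ring_corr_extend_root[OF assms, of x]) blast
  define C where "C = {(p, q). poly_corr G p q}"
  define G' where "G' = (\<lambda>(p, q). (poly p x, poly q y)) ` C"
  have mem: "(poly p x, poly q y) \<in> G'" if "poly_corr G p q" for p q
    using that unfolding G'_def C_def by force
  have memE: "\<exists>p q. poly_corr G p q \<and> u = poly p x \<and> v = poly q y" if "(u, v) \<in> G'" for u v
    using that unfolding G'_def C_def by auto
  have "C \<subseteq> {p. \<forall>i. coeff p i \<in> fst ` G} \<times> {q. \<forall>i. coeff q i \<in> snd ` G}"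
    unfolding C_def poly_corr_def by force
  moreover have "countable \<dots>" using assms by (intro countable_SIGMA countable_polys) auto
  ultimately have "countable G'" unfolding G'_def
    by (intro countable_image) (rule countable_subset)
  moreover have "G \<subseteq> G'"
  proof safe
    fix u v assume "(u, v) \<in> G"
    from mem[OF poly_corr_monom[OF this, of 0]] show "(u, v) \<in> G'" by (simp add: poly_monom)
  qed
  moreover have "(x, y) \<in> G'"
    using mem[OF poly_corr_monom[OF ring_corr_one, of 1]] by (simp add: poly_monom)
  moreover have "ring_corr G'"
    unfolding ring_corr_def
  proof (intro conjI allI impI)
    show "(1, 1) \<in> G'" using \<open>G \<subseteq> G'\<close> ring_corr_one by blast
  next
    fix u v u' v' assume "(u, v) \<in> G'" "(u', v') \<in> G'"
    then obtain p q p' q' where *: "poly_corr G p q" "u = poly p x" "v = poly q y"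
      "poly_corr G p' q'" "u' = poly p' x" "v' = poly q' y" using memE by meson
    show "(u - u', v - v') \<in> G'" using mem[OF poly_corr_diff[OF *(1,4)]] * by simp
    show "(u * u', v * v') \<in> G'" using mem[OF poly_corr_mult[OF *(1,4)]] * by simp
  next
    fix u v assume "(u, v) \<in> G'"
    then obtain p q where "poly_corr G p q" "u = poly p x" "v = poly q y" using memE by meson
    then show "u = 0 \<longleftrightarrow> v = 0" using y by simp
  qed
  ultimately show ?thesis using that by blast
qed

end

text \<open>Adjoins the elements one at a time. Countability is carried along because it keeps a
  transcendental partner available at each step.\<close>

lemma ring_corr_extend_finite:
  assumes "finite X" "ring_corr G" "countable G"
  shows "\<exists>G'. ring_corr G' \<and> countable G' \<and> G \<subseteq> G' \<and> X \<subseteq> fst ` G'"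
  using assms(1)
proof induction
  case empty
  then show ?case using assms by blast
next
  case (insert x X)
  then obtain G' where G': "ring_corr G'" "countable G'" "G \<subseteq> G'" "X \<subseteq> fst ` G'" by blast
  obtain G'' y where "ring_corr G''" "countable G''" "G' \<subseteq> G''" "(x, y) \<in> G''"
    using ring_corr_extend[OF G'(1,2)] .
  moreover from this have "insert x X \<subseteq> fst ` G''" using G'(4)
    by (metis (no_types, lifting) fst_conv image_eqI image_mono insert_subset order_trans)
  ultimately show ?case using G'(3) by blast
qed

section \<open>Algebraically independent tuples\<close>

text \<open>Syntax for multivariate integer polynomials. Over countably many variables there are
  countably many terms, so algebraic independence becomes a countable family of conditions.\<close>

datatype 'v ring_term = Var 'v | One | Minus "'v ring_term" "'v ring_term"
  | Times "'v ring_term" "'v ring_term"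

instance ring_term :: (countable) countable
  by countable_datatype

primrec teval :: "('v \<Rightarrow> complex) \<Rightarrow> 'v ring_term \<Rightarrow> complex" where
  "teval h (Var v) = h v"
| "teval h One = 1"
| "teval h (Minus s t) = teval h s - teval h t"
| "teval h (Times s t) = teval h s * teval h t"

lemma teval_cong: "(\<And>v. v \<in> set_ring_term t \<Longrightarrow> h v = g v) \<Longrightarrow> teval h t = teval g t"
  by (induction t) auto

text \<open>Isolates one variable, so that finiteness of the roots of a nonzero univariate
  polynomial can be used coordinate by coordinate.\<close>

lemma teval_upd_poly: "\<exists>p. \<forall>z. teval (h(v := z)) t = poly p z"
proof (induction t)
  case (Var w)
  show ?case by (rule exI[of _ "if w = v then [:0, 1:] else [:h w:]"]) auto
next
  case One
  show ?case by (rule exI[of _ 1]) auto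
next
  case (Minus s t)
  then obtain p q where "\<forall>z. teval (h(v := z)) s = poly p z" "\<forall>z. teval (h(v := z)) t = poly q z" by blast
  then show ?case by (intro exI[of _ "p - q"]) (simp del: fun_upd_apply)
next
  case (Times s t)
  then obtain p q where "\<forall>z. teval (h(v := z)) s = poly p z" "\<forall>z. teval (h(v := z)) t = poly q z" by blast
  then show ?case by (intro exI[of _ "p * q"]) (simp del: fun_upd_apply)
qed

lemma teval_measurable:
  assumes "\<And>v. (\<lambda>x. f x v) \<in> borel_measurable M"
  shows "(\<lambda>x. teval (f x) t) \<in> borel_measurable M"
  using assms by (induction t) auto

text \<open>Ring terms are integer polynomials, so this is algebraic independence over the rationals.\<close>

definition alg_indep :: "'v set \<Rightarrow> ('v \<Rightarrow> complex) \<Rightarrow> bool" where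
  "alg_indep I h \<longleftrightarrow> (\<forall>t. set_ring_term t \<subseteq> I \<longrightarrow> teval h t = 0 \<longrightarrow> (\<forall>g. teval g t = 0))"

lemma alg_indep_cong: "(\<And>v. v \<in> I \<Longrightarrow> h v = g v) \<Longrightarrow> alg_indep I h \<longleftrightarrow> alg_indep I g"
  unfolding alg_indep_def using teval_cong[of _ h g] by (metis subsetD)

section \<open>Almost sure algebraic independence under atomless product laws\<close>

lemma AE_not_in_finite:
  assumes "continuous_distribution D" "sets D = sets borel" "finite (S :: complex set)"
  shows "AE z in D. z \<notin> S"
proof -
  have "AE z in D. z \<noteq> s" for s
  proof (rule AE_I)
    show "{z \<in> space D. \<not> z \<noteq> s} \<subseteq> {s}" by auto
    show "{s} \<in> sets D" using assms by simp
    show "emeasure D {s} = 0" using assms(1) sets_eq_imp_space_eq[OF assms(2)]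
      unfolding continuous_distribution_def by simp
  qed
  then have "AE z in D. \<forall>s\<in>S. z \<noteq> s" using assms(3) by (intro AE_finite_allI)
  then show ?thesis by (rule AE_mp) auto
qed

text \<open>Induction on \<open>I\<close> with Fubini: starting from \<open>g\<close>, where the
  term is nonzero, coordinates are randomised one at a time. Given the earlier ones, the new
  coordinate almost surely avoids the finitely many roots of a nonzero polynomial, because its law
  has no atoms.\<close>

lemma AE_PiM_teval_nonzero:
  fixes D :: "'v \<Rightarrow> complex measure"
  assumes prob: "\<And>i. prob_space (D i)" and sets: "\<And>i. sets (D i) = sets borel"
    and "finite I" and "\<And>i. i \<in> I \<Longrightarrow> continuous_distribution (D i)" and "teval g t \<noteq> 0"
  shows "AE h in PiM I D. teval (\<lambda>i. if i \<in> I then h i else g i) t \<noteq> 0"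
  using assms(3-)
proof (induction I rule: finite_induct)
  case empty
  then show ?case by simp
next
  case (insert i I)
  interpret product_sigma_finite D
    using prob by (intro product_sigma_finite.intro prob_space_imp_sigma_finite)
  let ?ev = "\<lambda>J h. teval (\<lambda>i. if i \<in> J then h i else g i) t"
  let ?N = "{h \<in> space (PiM (insert i I) D). ?ev (insert i I) h = 0}"
  have meas: "?ev (insert i I) \<in> borel_measurable (PiM (insert i I) D)"
  proof (rule teval_measurable)
    fix v
    have "(\<lambda>h. h v) \<in> PiM (insert i I) D \<rightarrow>\<^sub>M borel" if "v \<in> insert i I"
      using measurable_component_singleton[OF that, of D] sets measurable_cong_sets by blast
    then show "(\<lambda>h. if v \<in> insert i I then h v else g v) \<in> borel_measurable (PiM (insert i I) D)"
      by (cases "v \<in> insert i I") auto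
  qed
  have "?N = ?ev (insert i I) -` {0} \<inter> space (PiM (insert i I) D)" by auto
  then have N: "?N \<in> sets (PiM (insert i I) D)"
    using measurable_sets[OF meas, of "{0}"] by simp
  have "AE x in PiM I D. ?ev I x \<noteq> 0" using insert by simp
  then have "AE x in PiM I D. (\<integral>\<^sup>+ y. indicator ?N (x(i := y)) \<partial>D i) = 0"
  proof (rule AE_mp, intro AE_I2 impI)
    fix x assume x: "x \<in> space (PiM I D)" and nz: "?ev I x \<noteq> 0"
    obtain p where p: "\<And>z. teval ((\<lambda>j. if j \<in> I then x j else g j)(i := z)) t = poly p z"
      using teval_upd_poly by meson
    \<comment> \<open>Giving the new variable the value \<open>g i\<close> restores the previous
      evaluation, which is nonzero.\<close>
    have "(\<lambda>j. if j \<in> I then x j else g j)(i := g i) = (\<lambda>j. if j \<in> I then x j else g j)"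
      using insert.hyps by auto
    with p[of "g i"] nz have "p \<noteq> 0" by auto
    then have "finite {z. poly p z = 0}" by (rule poly_roots_finite)
    from AE_not_in_finite[OF _ sets this] insert.prems
    have "AE z in D i. z \<notin> {z. poly p z = 0}" by simp
    moreover have "?ev (insert i I) (x(i := z)) = poly p z" for z
      unfolding p[symmetric] by (rule arg_cong[where f = "\<lambda>h. teval h t"]) auto
    ultimately have "AE z in D i. indicator ?N (x(i := z)) = (0 :: ennreal)"
      by (elim AE_mp) (auto simp: indicator_def)
    then show "(\<integral>\<^sup>+ y. indicator ?N (x(i := y)) \<partial>D i) = 0"
      by (subst nn_integral_cong_AE) auto
  qed
  then have "(\<integral>\<^sup>+ x. (\<integral>\<^sup>+ y. indicator ?N (x(i := y)) \<partial>D i) \<partial>PiM I D) = 0"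
    by (subst nn_integral_cong_AE) auto
  then have "(\<integral>\<^sup>+ h. indicator ?N h \<partial>PiM (insert i I) D) = 0"
    using N insert.hyps by (subst product_nn_integral_insert) auto
  then have "emeasure (PiM (insert i I) D) ?N = 0" using N by simp
  then show ?case using N by (subst AE_iff_measurable[OF N]) auto
qed

text \<open>A countable intersection of almost sure events, one for each term that is not
  identically zero.\<close>

lemma AE_PiM_alg_indep:
  fixes D :: "'v::countable \<Rightarrow> complex measure"
  assumes "\<And>i. i \<in> I \<Longrightarrow> prob_space (D i)" "\<And>i. i \<in> I \<Longrightarrow> sets (D i) = sets borel"
    and "finite I" and "\<And>i. i \<in> I \<Longrightarrow> continuous_distribution (D i)"
  shows "AE h in PiM I D. alg_indep I h"
proof -
  \<comment> \<open>Point masses fill the indices outside \<open>I\<close>, so that every index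
    carries a probability measure; the product over \<open>I\<close> is unchanged.\<close>
  define D' where "D' i = (if i \<in> I then D i else return borel 0)" for i
  have P: "PiM I D = PiM I D'" by (intro PiM_cong) (auto simp: D'_def)
  have "AE h in PiM I D. set_ring_term t \<subseteq> I \<longrightarrow> teval h t = 0 \<longrightarrow> (\<forall>g. teval g t = 0)" for t
  proof (cases "\<exists>g. teval g t \<noteq> 0 \<and> set_ring_term t \<subseteq> I")
    case True
    then obtain g where g: "teval g t \<noteq> 0" and t: "set_ring_term t \<subseteq> I" by blast
    have "AE h in PiM I D'. teval (\<lambda>i. if i \<in> I then h i else g i) t \<noteq> 0"
      using assms g by (intro AE_PiM_teval_nonzero) (auto simp: D'_def intro: prob_space_return)
    moreover have "teval (\<lambda>i. if i \<in> I then h i else g i) t = teval h t" for h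
      using t by (intro teval_cong) auto
    ultimately have "AE h in PiM I D'. teval h t \<noteq> 0" by simp
    then show ?thesis unfolding P by (rule AE_mp) (intro AE_I2, blast)
  qed auto
  then show ?thesis unfolding alg_indep_def by (subst AE_all_countable) blast
qed

text \<open>Existence by probability: independent uniform draws from the balls almost surely have
  both properties.\<close>

lemma exists_alg_indep_near:
  fixes h0 :: "'v::countable \<Rightarrow> complex"
  assumes "finite I" "\<epsilon> > 0"
  obtains h where "alg_indep I h" "\<And>i. i \<in> I \<Longrightarrow> norm (h i - h0 i) < \<epsilon>"
proof -
  define D where "D i = uniform_measure lborel (ball (h0 i) \<epsilon>)" for i
  have pos: "emeasure lborel (ball (h0 i) \<epsilon>) \<noteq> 0" for i
    using content_ball_pos[OF \<open>\<epsilon> > 0\<close>, of "h0 i"] by (auto simp: measure_def)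
  have fin: "emeasure lborel (ball (h0 i) \<epsilon>) \<noteq> \<infinity>" for i
    using emeasure_lborel_ball_finite[of "h0 i" \<epsilon>] by auto
  have prob: "prob_space (D i)" for i
    unfolding D_def using pos fin by (rule prob_space_uniform_measure)
  have "continuous_distribution (D i)" for i
    unfolding continuous_distribution_def
  proof
    fix z :: complex
    have "emeasure lborel (ball (h0 i) \<epsilon> \<inter> {z}) \<le> emeasure lborel {z}"
      by (intro emeasure_mono) auto
    then show "emeasure (D i) {z} = 0" by (simp add: D_def)
  qed
  then have 1: "AE h in PiM I D. alg_indep I h"
    using assms prob by (intro AE_PiM_alg_indep) (auto simp: D_def)
  have "AE z in D i. norm (z - h0 i) < \<epsilon>" for i
    unfolding D_def by (intro AE_uniform_measureI) (auto simp: dist_norm norm_minus_commute)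
  then have "AE h in PiM I D. norm (h i - h0 i) < \<epsilon>" if "i \<in> I" for i
    using that prob by (intro AE_PiM_component[where P = "\<lambda>z. norm (z - h0 i) < \<epsilon>"])
  then have 2: "AE h in PiM I D. \<forall>i\<in>I. norm (h i - h0 i) < \<epsilon>"
    using assms by (intro AE_finite_allI)
  interpret prob_space "PiM I D" using prob by (rule prob_space_PiM)
  from AE_conjI[OF 1 2] obtain h where "alg_indep I h" "\<forall>i\<in>I. norm (h i - h0 i) < \<epsilon>"
    using eventually_happens'[of "ae_filter (PiM I D)"] emeasure_space_1 ae_filter_eq_bot_iff
    by (metis (no_types, lifting) zero_neq_one)
  then show ?thesis using that by blast
qed

text \<open>An integer polynomial in the variables \<open>I\<close> vanishes at either tuple only if
  it vanishes identically, so pairing its values at \<open>h'\<close> and \<open>h\<close> is a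
  correspondence. Once extended over \<open>X\<close>, it lets \<open>\<sigma>\<close> carry a
  solution found at \<open>h'\<close> over to \<open>h\<close>.\<close>

lemma alg_indep_ring_corr:
  fixes h' h :: "'v::countable \<Rightarrow> complex"
  assumes "alg_indep I h'" "alg_indep I h" "finite X"
  obtains G \<sigma> where "ring_corr G" "\<And>x. x \<in> X \<Longrightarrow> (x, \<sigma> x) \<in> G" "\<And>i. i \<in> I \<Longrightarrow> (h' i, h i) \<in> G"
proof -
  define G0 where "G0 = (\<lambda>t. (teval h' t, teval h t)) ` {t. set_ring_term t \<subseteq> I}"
  have mem: "(teval h' t, teval h t) \<in> G0" if "set_ring_term t \<subseteq> I" for t
    using that unfolding G0_def by blast
  have "ring_corr G0"
    unfolding ring_corr_def
  proof (intro conjI allI impI)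
    show "(1, 1) \<in> G0" using mem[of One] by simp
  next
    fix x y x' y' assume "(x, y) \<in> G0" "(x', y') \<in> G0"
    then obtain t t' where *: "set_ring_term t \<subseteq> I" "set_ring_term t' \<subseteq> I"
      "x = teval h' t" "y = teval h t" "x' = teval h' t'" "y' = teval h t'"
      unfolding G0_def by blast
    show "(x - x', y - y') \<in> G0" using mem[of "Minus t t'"] * by simp
    show "(x * x', y * y') \<in> G0" using mem[of "Times t t'"] * by simp
  next
    fix x y assume "(x, y) \<in> G0"
    then obtain t where "set_ring_term t \<subseteq> I" "x = teval h' t" "y = teval h t"
      unfolding G0_def by blast
    then show "x = 0 \<longleftrightarrow> y = 0" using assms(1,2) unfolding alg_indep_def by metis
  qed
  moreover have "countable G0" unfolding G0_def by simp
  ultimately obtain G where G: "ring_corr G" "G0 \<subseteq> G" "X \<subseteq> fst ` G"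
    using ring_corr_extend_finite[OF assms(3)] by blast
  have "(h' i, h i) \<in> G" if "i \<in> I" for i using mem[of "Var i"] that G(2) by auto
  moreover have "(x, SOME y. (x, y) \<in> G) \<in> G" if "x \<in> X" for x
    using that G(3) by (metis (no_types, lifting) fst_conv imageE prod.collapse someI_ex subsetD)
  ultimately show ?thesis by (intro that[of G "\<lambda>x. SOME y. (x, y) \<in> G"] G(1))
qed

section \<open>Perturbation estimates\<close>

text \<open>Banach's iteration from 0 for the sup norm on the unit polydisc, with every estimate
  uniform in the coordinate; the index type may be infinite.\<close>

lemma coordinatewise_contraction_fixpoint:
  fixes T :: "('i \<Rightarrow> 'b::banach) \<Rightarrow> 'i \<Rightarrow> 'b"
  assumes bound: "\<And>x i. (\<And>j. norm (x j) \<le> 1) \<Longrightarrow> norm (T x i) \<le> 1"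
    and lip: "\<And>x y c i. (\<And>j. norm (x j) \<le> 1) \<Longrightarrow> (\<And>j. norm (y j) \<le> 1) \<Longrightarrow>
      (\<And>j. norm (x j - y j) \<le> c) \<Longrightarrow> norm (T x i - T y i) \<le> c / 2"
  obtains x where "\<And>i. norm (x i) \<le> 1" "T x = x"
proof -
  define X where "X n = (T ^^ n) (\<lambda>_. 0)" for n
  have X1: "norm (X n i) \<le> 1" for n i
    by (induction n arbitrary: i) (auto simp: X_def intro: bound)
  have step: "norm (X (Suc n) i - X n i) \<le> (1/2) ^ n" for n i
  proof (induction n arbitrary: i)
    case 0
    show ?case using X1[of 1 i] by (simp add: X_def)
  next
    case (Suc n)
    have "norm (T (X (Suc n)) i - T (X n) i) \<le> (1/2) ^ n / 2" by (rule lip[OF X1 X1 Suc])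
    then show ?case by (simp add: X_def)
  qed
  \<comment> \<open>The right-hand side is the exact partial geometric sum; without the subtracted
    term the bound would not be inductive.\<close>
  have tail: "norm (X (m + n) i - X n i) \<le> 2 * (1/2) ^ n - (1/2) ^ n * 2 * (1/2) ^ m" for m n i
  proof (induction m)
    case (Suc m)
    have "norm (X (Suc m + n) i - X n i) \<le>
        norm (X (Suc (m + n)) i - X (m + n) i) + norm (X (m + n) i - X n i)"
      using norm_triangle_ineq[of "X (Suc (m + n)) i - X (m + n) i" "X (m + n) i - X n i"] by simp
    also have "\<dots> \<le> (1/2) ^ (m + n) + (2 * (1/2) ^ n - (1/2) ^ n * 2 * (1/2) ^ m)"
      by (intro add_mono step Suc)
    finally show ?case by (simp add: power_add field_simps)
  qed simp
  have tail': "norm (X m i - X n i) \<le> 2 * (1/2) ^ n" if "m \<ge> n" for m n i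
  proof -
    have "norm (X m i - X n i) \<le> 2 * (1/2) ^ n - (1/2) ^ n * 2 * (1/2) ^ (m - n)"
      using tail[of "m - n" n i] that by simp
    also have "\<dots> \<le> 2 * (1/2) ^ n" by simp
    finally show ?thesis .
  qed
  have small: "\<exists>n. c * (1/2) ^ n < e" if "0 < e" "0 < c" for c e :: real
    using real_arch_pow_inv[of "e / c" "1/2"] that by (auto simp: field_simps)
  have "Cauchy (\<lambda>n. X n i)" for i
  proof (rule metric_CauchyI)
    fix e :: real assume "e > 0"
    then obtain n0 where n0: "4 * (1/2) ^ n0 < e" using small[of e 4] by auto
    show "\<exists>M. \<forall>m\<ge>M. \<forall>n\<ge>M. dist (X m i) (X n i) < e"
    proof (intro exI[of _ n0] allI impI)
      fix m n assume "n0 \<le> m" "n0 \<le> n"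
      then have "norm (X m i - X n0 i) \<le> 2 * (1/2) ^ n0" "norm (X n i - X n0 i) \<le> 2 * (1/2) ^ n0"
        using tail' by blast+
      with n0 norm_triangle_ineq4[of "X m i - X n0 i" "X n i - X n0 i"]
      show "dist (X m i) (X n i) < e" by (simp add: dist_norm)
    qed
  qed
  then have conv: "convergent (\<lambda>n. X n i)" for i by (rule Cauchy_convergent)
  define x where "x i = lim (\<lambda>n. X n i)" for i
  have x: "(\<lambda>n. X n i) \<longlonglongrightarrow> x i" for i
    using conv unfolding x_def convergent_LIMSEQ_iff .
  have x1: "norm (x i) \<le> 1" for i
    using X1 by (intro LIMSEQ_le_const2[OF tendsto_norm[OF x]]) blast
  have close: "norm (x i - X n i) \<le> 2 * (1/2) ^ n" for i n
  proof (rule LIMSEQ_le_const2)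
    show "(\<lambda>m. norm (X m i - X n i)) \<longlonglongrightarrow> norm (x i - X n i)"
      by (intro tendsto_norm tendsto_diff x tendsto_const)
    show "\<exists>N. \<forall>m\<ge>N. norm (X m i - X n i) \<le> 2 * (1/2) ^ n" using tail' by blast
  qed
  have "T x i = x i" for i
  proof (rule ccontr)
    assume "T x i \<noteq> x i"
    \<comment> \<open>Both \<open>x\<close> and \<open>T x\<close> lie within
      \<open>(1/2) ^ n\<close> of the iterate \<open>X (Suc n)\<close>, so their distance is at most
      twice that, less than the factor 3 chosen here.\<close>
    then obtain n where n: "3 * (1/2) ^ n < norm (T x i - x i)"
      using small[of "norm (T x i - x i)" 3] by auto
    have "norm (T x i - X (Suc n) i) \<le> (1/2) ^ n"
      using lip[OF x1 X1 close] by (simp add: X_def)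
    moreover have "norm (x i - X (Suc n) i) \<le> (1/2) ^ n" using close[of i "Suc n"] by simp
    moreover have "norm (T x i - x i) \<le> norm (T x i - X (Suc n) i) + norm (x i - X (Suc n) i)"
      using norm_triangle_ineq4[of "T x i - X (Suc n) i" "x i - X (Suc n) i"] by simp
    moreover have "(0::real) < (1/2) ^ n" by simp
    ultimately show False using n by linarith
  qed
  then show ?thesis using that x1 by blast
qed

lemma bilinear_form_bound:
  fixes L R :: "nat \<Rightarrow> complex" and n m :: nat and s t \<epsilon> :: real
  assumes "\<And>i. i < n \<Longrightarrow> norm (L i) \<le> s" "\<And>l. l < m \<Longrightarrow> norm (R l) \<le> t"
    "\<And>i l. i < n \<Longrightarrow> l < m \<Longrightarrow> norm (D i l) \<le> \<epsilon>" "0 \<le> s" "0 \<le> \<epsilon>"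
  shows "norm (\<Sum>i<n. \<Sum>l<m. L i * D i l * R l) \<le> real n * real m * (s * \<epsilon> * t)"
proof -
  have "norm (\<Sum>i<n. \<Sum>l<m. L i * D i l * R l) \<le> (\<Sum>i<n. \<Sum>l<m. s * \<epsilon> * t)"
    using assms by (intro sum_norm_le) (auto simp: norm_mult intro!: mult_mono)
  then show ?thesis by (simp add: mult.assoc)
qed

text \<open>Diagonal dominance: at a coordinate where a kernel vector has its largest modulus
  \<open>m\<close>, the equation would give \<open>m\<close> at most
  \<open>n * \<delta> * m\<close>, which is below \<open>m\<close>.\<close>

lemma det_nonzero_near_identity:
  fixes E :: "nat \<Rightarrow> nat \<Rightarrow> complex" and n :: nat and \<delta> :: real
  assumes "\<And>a b. a < n \<Longrightarrow> b < n \<Longrightarrow> norm (E a b) \<le> \<delta>" "real n * \<delta> < 1"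
  shows "det (mat n n (\<lambda>(a, b). of_bool (a = b) + E a b)) \<noteq> 0"
proof
  let ?A = "mat n n (\<lambda>(a, b). of_bool (a = b) + E a b)"
  assume "det ?A = 0"
  then obtain v where v: "v \<in> carrier_vec n" "v \<noteq> 0\<^sub>v n" "?A *\<^sub>v v = 0\<^sub>v n"
    using det_0_iff_vec_prod_zero_field[of ?A n] by auto
  define m where "m = Max ((\<lambda>b. norm (v $ b)) ` {..<n})"
  from v obtain c where c: "c < n" "v $ c \<noteq> 0" by (metis carrier_vecD eq_vecI index_zero_vec)
  have le: "norm (v $ b) \<le> m" if "b < n" for b unfolding m_def using that by (intro Max_ge) auto
  have "m \<in> (\<lambda>b. norm (v $ b)) ` {..<n}" unfolding m_def using c by (intro Max_in) auto
  then obtain a where a: "a < n" "norm (v $ a) = m" by auto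
  have m: "m > 0" using le[OF c(1)] c(2) by (smt (verit) zero_less_norm_iff)
  have "0 = (?A *\<^sub>v v) $ a" using v a by simp
  also have "\<dots> = (\<Sum>b<n. (of_bool (a = b) + E a b) * v $ b)"
    using a(1) v(1) by (auto simp: scalar_prod_def atLeast0LessThan intro!: sum.cong)
  also have "\<dots> = (\<Sum>b<n. if b = a then v $ b else 0) + (\<Sum>b<n. E a b * v $ b)"
    by (subst sum.distrib[symmetric]) (auto intro!: sum.cong simp: algebra_simps)
  also have "(\<Sum>b<n. if b = a then v $ b else 0) = v $ a" using a by simp
  finally have "v $ a = - (\<Sum>b<n. E a b * v $ b)" by (simp add: eq_neg_iff_add_eq_0)
  then have "m = norm (\<Sum>b<n. E a b * v $ b)" using a by (metis norm_minus_cancel)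
  also have "\<dots> \<le> (\<Sum>b<n. \<delta> * m)"
    using assms(1) a(1) le m order_trans[OF norm_ge_zero assms(1)]
    by (intro sum_norm_le) (auto simp: norm_mult intro!: mult_mono)
  also have "\<dots> = (real n * \<delta>) * m" by simp
  also have "\<dots> < m" using assms(2) m by simp
  finally show False by simp
qed

section \<open>The alignment equations\<close>

text \<open>Row \<open>a\<close> of the Hermitian transpose of the receiver. Parametrising the
  transpose keeps the equations free of conjugates, which a ring isomorphism need not
  respect.\<close>

definition rx_row :: "(nat \<Rightarrow> nat) \<Rightarrow> (nat \<times> nat \<times> nat \<Rightarrow> complex) \<Rightarrow> nat \<Rightarrow> nat \<Rightarrow> nat \<Rightarrow> complex" where
  "rx_row d w k a i = (if i < d k then of_bool (i = a) else w (k, a, i))"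

definition tx_col :: "(nat \<Rightarrow> nat) \<Rightarrow> (nat \<times> nat \<times> nat \<Rightarrow> complex) \<Rightarrow> nat \<Rightarrow> nat \<Rightarrow> nat \<Rightarrow> complex" where
  "tx_col d v j l b = (if l < d j then of_bool (l = b) else v (j, l, b))"

text \<open>Entry \<open>(a, b)\<close> of the product of the transposed receiver, the channel and
  the transmitter; \<open>h (k, j, i, l)\<close> is entry \<open>(i, l)\<close> of channel
  \<open>(k, j)\<close>.\<close>

definition link :: "(nat \<Rightarrow> nat) \<Rightarrow> (nat \<Rightarrow> nat) \<Rightarrow> (nat \<Rightarrow> nat) \<Rightarrow> (nat \<times> nat \<times> nat \<Rightarrow> complex) \<Rightarrow>
    (nat \<times> nat \<times> nat \<Rightarrow> complex) \<Rightarrow> (nat \<times> nat \<times> nat \<times> nat \<Rightarrow> complex) \<Rightarrow>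
    nat \<Rightarrow> nat \<Rightarrow> nat \<Rightarrow> nat \<Rightarrow> complex" where
  "link M N d w v h k j a b =
     (\<Sum>i<N k. \<Sum>l<M j. rx_row d w k a i * h (k, j, i, l) * tx_col d v j l b)"

text \<open>The transceivers are normalised: \<open>U\<^sub>k\<^sup>H\<close> is the row of blocks \<open>I\<close>, \<open>w\<^sub>k\<close>, and \<open>V\<^sub>j\<close>
  is the column of blocks \<open>I\<close>, \<open>v\<^sub>j\<close>.\<close>

definition normalised_feasible ::
    "nat \<Rightarrow> (nat \<Rightarrow> nat) \<Rightarrow> (nat \<Rightarrow> nat) \<Rightarrow> (nat \<Rightarrow> nat) \<Rightarrow> (nat \<times> nat) set \<Rightarrow>
      (nat \<times> nat \<times> nat \<times> nat \<Rightarrow> complex) \<Rightarrow> bool" where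
  "normalised_feasible K M N d A h \<longleftrightarrow> (\<exists>w v.
     (\<forall>(k, j)\<in>A. \<forall>a<d k. \<forall>b<d j. link M N d w v h k j a b = 0) \<and>
     (\<forall>k\<in>{1..K}. det (mat (d k) (d k) (\<lambda>(a, b). link M N d w v h k k a b)) \<noteq> 0))"

section \<open>Transfer of solvability between algebraically independent channels\<close>

lemma ring_corr_of_bool: "ring_corr G \<Longrightarrow> (of_bool P, of_bool P) \<in> G"
  using ring_corr_one ring_corr_zero by simp

lemma ring_corr_signof: "ring_corr G \<Longrightarrow> (signof p, signof p) \<in> G"
  unfolding sign_def using ring_corr_one ring_corr_minus[OF _ ring_corr_one] by simp

text \<open>By the Leibniz formula the determinant is an integer polynomial in the entries.\<close>

lemma ring_corr_det:
  assumes G: "ring_corr G" and fg: "\<And>a b. a < n \<Longrightarrow> b < n \<Longrightarrow> (f a b, g a b) \<in> G"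
  shows "(det (mat n n (\<lambda>(a, b). f a b)), det (mat n n (\<lambda>(a, b). g a b))) \<in> G"
proof -
  have "p i < n" if "p permutes {0..<n}" "i < n" for p i
    using permutes_in_image[OF that(1), of i] that(2) by simp
  then show ?thesis
    by (auto simp: det_def'[of _ n] intro!: ring_corr_sum[OF G] ring_corr_mult[OF G]
        ring_corr_signof[OF G] ring_corr_prod[OF G] fg)
qed

text \<open>The solution at \<open>h'\<close> is pushed through a correspondence taking
  \<open>h'\<close> to \<open>h\<close>. Links and determinants are integer polynomials in channel
  and unknowns, so their vanishing and nonvanishing are preserved.\<close>

lemma normalised_feasible_transfer:
  assumes feas: "normalised_feasible K M N d A h'"
    and A: "A \<subseteq> {1..K} \<times> {1..L}" and "K \<le> L"
    and I: "I = {(k, j, a, b). k \<in> {1..K} \<and> j \<in> {1..L} \<and> a < N k \<and> b < M j}"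
    and gen: "alg_indep I h'" "alg_indep I h"
  shows "normalised_feasible K M N d A h"
proof -
  obtain w' v' where
    zero': "\<And>k j a b. (k, j) \<in> A \<Longrightarrow> a < d k \<Longrightarrow> b < d j \<Longrightarrow> link M N d w' v' h' k j a b = 0" and
    det': "\<And>k. k \<in> {1..K} \<Longrightarrow> det (mat (d k) (d k) (\<lambda>(a, b). link M N d w' v' h' k k a b)) \<noteq> 0"
    using feas unfolding normalised_feasible_def by blast
  \<comment> \<open>Only these entries of the unknowns enter the relevant links, so finitely many
    numbers have to be adjoined.\<close>
  define W where "W = (SIGMA k:{1..K}. {..<d k} \<times> {..<N k})"
  define V where "V = (SIGMA j:{1..L}. {..<M j} \<times> {..<d j})"
  have "finite (w' ` W \<union> v' ` V)" unfolding W_def V_def by auto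
  from alg_indep_ring_corr[OF gen this] obtain G \<sigma> where G: "ring_corr G"
    and \<sigma>: "\<And>x. x \<in> w' ` W \<union> v' ` V \<Longrightarrow> (x, \<sigma> x) \<in> G"
    and h: "\<And>i. i \<in> I \<Longrightarrow> (h' i, h i) \<in> G" by metis
  define w where "w = \<sigma> \<circ> w'"
  define v where "v = \<sigma> \<circ> v'"
  have link: "(link M N d w' v' h' k j a b, link M N d w v h k j a b) \<in> G"
    if "k \<in> {1..K}" "j \<in> {1..L}" "a < d k" "b < d j" for k j a b
  proof -
    have "(rx_row d w' k a i, rx_row d w k a i) \<in> G" if "i < N k" for i
      using \<open>k \<in> {1..K}\<close> \<open>a < d k\<close> that \<sigma>[of "w' (k, a, i)"] ring_corr_of_bool[OF G]
      by (auto simp: rx_row_def w_def W_def)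
    moreover have "(tx_col d v' j l b, tx_col d v j l b) \<in> G" if "l < M j" for l
      using \<open>j \<in> {1..L}\<close> \<open>b < d j\<close> that \<sigma>[of "v' (j, l, b)"] ring_corr_of_bool[OF G]
      by (auto simp: tx_col_def v_def V_def)
    moreover have "(h' (k, j, i, l), h (k, j, i, l)) \<in> G" if "i < N k" "l < M j" for i l
      using \<open>k \<in> {1..K}\<close> \<open>j \<in> {1..L}\<close> that by (intro h) (simp add: I)
    ultimately show ?thesis unfolding link_def
      by (intro ring_corr_sum[OF G] ring_corr_mult[OF G]) auto
  qed
  have "link M N d w v h k j a b = 0" if "(k, j) \<in> A" "a < d k" "b < d j" for k j a b
    using zero'[OF that] link[of k j a b] ring_corr_zero_iff[OF G] that A by blast
  moreover have "det (mat (d k) (d k) (\<lambda>(a, b). link M N d w v h k k a b)) \<noteq> 0" if "k \<in> {1..K}" for k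
  proof -
    have "(det (mat (d k) (d k) (\<lambda>(a, b). link M N d w' v' h' k k a b)),
        det (mat (d k) (d k) (\<lambda>(a, b). link M N d w v h k k a b))) \<in> G"
      using that \<open>K \<le> L\<close> by (intro ring_corr_det[OF G] link) auto
    with ring_corr_zero_iff[OF G] det'[OF that] show ?thesis by blast
  qed
  ultimately show ?thesis unfolding normalised_feasible_def by blast
qed

section \<open>From normalised solutions to matrices with rank conditions\<close>

text \<open>The identity block on top is a nonsingular minor of order \<open>m\<close>.\<close>

lemma full_column_rankI:
  fixes B :: "complex mat"
  assumes B: "B \<in> carrier_mat n m" and "m \<le> n"
    and top: "\<And>l b. l < m \<Longrightarrow> b < m \<Longrightarrow> B $$ (l, b) = of_bool (l = b)"
  shows "vec_space.rank n B = m"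
proof -
  \<comment> \<open>An initial segment enumerates itself, so the submatrix below is the leading
    block.\<close>
  have pick: "pick {..<m} i = i" if "i < m" for i
    using that
  proof (induction i)
    case 0
    then show ?case by (auto intro!: Least_equality)
  next
    case (Suc i)
    then show ?case by (auto intro!: Least_equality)
  qed
  have "{i. i < n \<and> i \<in> {..<m}} = {..<m}" "{i. i < m \<and> i \<in> {..<m}} = {..<m}"
    using \<open>m \<le> n\<close> by auto
  then have "submatrix B {..<m} {..<m} = 1\<^sub>m m"
    using B top by (auto simp: submatrix_def pick one_mat_def intro!: cong_mat)
  then have "card {j. j < m \<and> j \<in> {..<m}} \<le> vec_space.rank n B"
    by (intro vec_space.rank_gt_minor[OF B, of "{..<m}"]) simp
  moreover have "{j. j < m \<and> j \<in> {..<m}} = {..<m}" by auto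
  ultimately have "m \<le> vec_space.rank n B" by simp
  then show ?thesis using vec_space.rank_le_nc[OF B] by simp
qed

text \<open>Conjugating the entries of \<open>U\<close> cancels the conjugation in the adjoint, so
  the matrix products have the links as entries. Nonzero determinants give the ranks of the direct
  links, the identity block those of the jammers.\<close>

lemma gia_feasible_if_normalised:
  assumes "normalised_feasible K M N d A (\<lambda>(k, j, a, b). H k j $$ (a, b))"
    and A: "A \<subseteq> {1..K} \<times> {1..K+J}"
    and H: "\<And>k j. k \<in> {1..K} \<Longrightarrow> j \<in> {1..K+J} \<Longrightarrow> H k j \<in> carrier_mat (N k) (M j)"
    and dM: "\<And>j. j \<in> {1..K+J} \<Longrightarrow> d j \<le> M j"
  shows "gia_feasible K J M N d H A"
proof -
  let ?h = "\<lambda>(k, j, a, b). H k j $$ (a, b)"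
  obtain w v where
    zero: "\<And>k j a b. (k, j) \<in> A \<Longrightarrow> a < d k \<Longrightarrow> b < d j \<Longrightarrow> link M N d w v ?h k j a b = 0" and
    det: "\<And>k. k \<in> {1..K} \<Longrightarrow> det (mat (d k) (d k) (\<lambda>(a, b). link M N d w v ?h k k a b)) \<noteq> 0"
    using assms(1) unfolding normalised_feasible_def by blast
  define U where "U k = mat (N k) (d k) (\<lambda>(i, a). cnj (rx_row d w k a i))" for k
  define V where "V j = mat (M j) (d j) (\<lambda>(l, b). tx_col d v j l b)" for j
  have adj: "mat_adjoint (U k) = mat (d k) (N k) (\<lambda>(a, i). rx_row d w k a i)" for k
    unfolding mat_adjoint_def U_def by (intro eq_matI) (auto simp: mat_of_rows_index)
  have prod: "mat_adjoint (U k) * H k j * V j = mat (d k) (d j) (\<lambda>(a, b). link M N d w v ?h k j a b)"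
    if "k \<in> {1..K}" "j \<in> {1..K+J}" for k j
  proof (rule eq_matI)
    fix a b assume ab: "a < dim_row (mat (d k) (d j) (\<lambda>(a, b). link M N d w v ?h k j a b))"
      "b < dim_col (mat (d k) (d j) (\<lambda>(a, b). link M N d w v ?h k j a b))"
    have "(mat_adjoint (U k) * H k j * V j) $$ (a, b) =
        (\<Sum>l<M j. (\<Sum>i<N k. rx_row d w k a i * H k j $$ (i, l)) * tx_col d v j l b)"
      using ab H[OF that] by (simp add: adj V_def scalar_prod_def atLeast0LessThan)
    also have "\<dots> = link M N d w v ?h k j a b"
      unfolding link_def by (subst sum.swap) (simp add: sum_distrib_right)
    finally show "(mat_adjoint (U k) * H k j * V j) $$ (a, b) =
        mat (d k) (d j) (\<lambda>(a, b). link M N d w v ?h k j a b) $$ (a, b)" using ab by simp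
  qed (use H[OF that] in \<open>auto simp: adj V_def\<close>)
  have "vec_space.rank (d k) (mat_adjoint (U k) * H k k * V k) = d k" if "k \<in> {1..K}" for k
    using that det vec_space.det_rank_iff[of "mat_adjoint (U k) * H k k * V k" "d k"] by (auto simp: prod)
  moreover have "vec_space.rank (M j) (V j) = d j" if "j \<in> {1..K+J}" for j
    using dM[OF that] by (intro full_column_rankI) (auto simp: V_def tx_col_def)
  moreover have "mat_adjoint (U k) * H k j * V j = 0\<^sub>m (d k) (d j)" if "(k, j) \<in> A" for k j
  proof -
    have "k \<in> {1..K}" "j \<in> {1..K+J}" using that A by auto
    then show ?thesis using zero[OF that] by (auto simp: prod)
  qed
  moreover have "U k \<in> carrier_mat (N k) (d k)" "V j \<in> carrier_mat (M j) (d j)" for k j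
    by (auto simp: U_def V_def)
  ultimately show ?thesis unfolding gia_feasible_def
    by (intro exI[of _ U] exI[of _ V]) auto
qed

section \<open>Solvability near a channel of zeros and ones\<close>

text \<open>Reserves distinct indices outside the identity block; the hypothesis has the form of
  properness.\<close>

lemma exists_inj_into_upper:
  assumes "finite S" "int (card S) \<le> int n - int m"
  obtains f where "inj_on f S" "f ` S \<subseteq> {m..<n}"
proof -
  have "card S \<le> card {m..<n}" using assms(2) by simp
  then show ?thesis using that card_le_inj[OF assms(1), of "{m..<n}"] by blast
qed

lemma card_indexed_pairs:
  assumes "finite S"
  shows "card {(j, b). j \<in> S \<and> b < (d j :: nat)} = (\<Sum>j\<in>S. d j)"
proof -
  have "{(j, b). j \<in> S \<and> b < d j} = (SIGMA j:S. {..<d j})" by auto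
  then show ?thesis using assms by simp
qed

text \<open>The point \<open>h0\<close> is chosen so that there the equation for entry \<open>(a, b)\<close> of link \<open>(k, j)\<close> reads
  \<open>x (k, j, a, b) = 0\<close>, where \<open>x (k, j, a, b)\<close> is an entry of \<open>w\<^sub>k\<close> or \<open>v\<^sub>j\<close> reserved for this equation;
  properness says that there is room for the reservations. Near \<open>h0\<close> the equations then form a
  fixed-point problem for a contraction of the unit polydisc.\<close>

lemma normalised_feasible_near:
  assumes A: "A \<subseteq> {(k, j). k \<in> {1..K} \<and> j \<in> {1..L} \<and> k \<noteq> j}" and "K \<le> L"
    and Aeq: "A = (\<Union>k\<in>{1..K}. Ar k) \<union> (\<Union>j\<in>{1..L}. At j)"
    and Ar: "\<And>k. k \<in> {1..K} \<Longrightarrow> Ar k \<subseteq> {k} \<times> UNIV \<and> int (\<Sum>j | (k, j) \<in> Ar k. d j) \<le> int (N k) - int (d k)"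
    and At: "\<And>j. j \<in> {1..L} \<Longrightarrow> At j \<subseteq> UNIV \<times> {j} \<and> int (\<Sum>k | (k, j) \<in> At j. d k) \<le> int (M j) - int (d j)"
  obtains h0 \<epsilon> where "\<epsilon> > 0"
    "\<And>h. (\<And>k j i l. k \<in> {1..K} \<Longrightarrow> j \<in> {1..L} \<Longrightarrow> i < N k \<Longrightarrow> l < M j \<Longrightarrow>
        norm (h (k, j, i, l) - h0 (k, j, i, l)) < \<epsilon>) \<Longrightarrow> normalised_feasible K M N d A h"
proof -
  \<comment> \<open>One column of \<open>w\<close> at receiver \<open>k\<close> is reserved for each
    stream \<open>b\<close> of each \<open>j\<close> aligned there; its entry in row
    \<open>a\<close> serves equation \<open>(k, j, a, b)\<close>. \<open>R\<close> does the same for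
    rows of \<open>v\<close>.\<close>
  define S where "S k = {(j, b). j \<in> {j. (k, j) \<in> Ar k} \<and> b < d j}" for k
  define R where "R j = {(k, a). k \<in> {k. (k, j) \<in> At j} \<and> a < d k}" for j
  have inA: "k \<in> {1..K}" "j \<in> {1..L}" "k \<noteq> j" if "(k, j) \<in> A" for k j
    using subsetD[OF A that] by simp_all
  have ArA: "(k, j) \<in> A" if "k \<in> {1..K}" "(k, j) \<in> Ar k" for k j
    unfolding Aeq using that by blast
  have AtA: "(k, j) \<in> A" if "j \<in> {1..L}" "(k, j) \<in> At j" for k j
    unfolding Aeq using that by blast
  have finr: "finite {j. (k, j) \<in> Ar k}" if "k \<in> {1..K}" for k
    by (rule finite_subset[of _ "{1..L}"]) (use inA(2) ArA that in blast, simp)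
  have fint: "finite {k. (k, j) \<in> At j}" if "j \<in> {1..L}" for j
    by (rule finite_subset[of _ "{1..K}"]) (use inA(1) AtA that in blast, simp)
  have "\<exists>f. inj_on f (S k) \<and> f ` S k \<subseteq> {d k..<N k}" if "k \<in> {1..K}" for k
  proof (rule exists_inj_into_upper[of "S k" "N k" "d k"])
    show "finite (S k)" unfolding S_def
      by (rule finite_subset[of _ "SIGMA j:{j. (k, j) \<in> Ar k}. {..<d j}"]) (auto intro: finr[OF that])
    show "int (card (S k)) \<le> int (N k) - int (d k)"
      using Ar[OF that] unfolding S_def card_indexed_pairs[OF finr[OF that]] by simp
  qed blast
  then obtain \<pi> where \<pi>_inj: "\<And>k. k \<in> {1..K} \<Longrightarrow> inj_on (\<pi> k) (S k)"
    and \<pi>: "\<And>k. k \<in> {1..K} \<Longrightarrow> \<pi> k ` S k \<subseteq> {d k..<N k}" by metis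
  have "\<exists>f. inj_on f (R j) \<and> f ` R j \<subseteq> {d j..<M j}" if "j \<in> {1..L}" for j
  proof (rule exists_inj_into_upper[of "R j" "M j" "d j"])
    show "finite (R j)" unfolding R_def
      by (rule finite_subset[of _ "SIGMA k:{k. (k, j) \<in> At j}. {..<d k}"]) (auto intro: fint[OF that])
    show "int (card (R j)) \<le> int (M j) - int (d j)"
      using At[OF that] unfolding R_def card_indexed_pairs[OF fint[OF that]] by simp
  qed blast
  then obtain \<rho> where \<rho>_inj: "\<And>j. j \<in> {1..L} \<Longrightarrow> inj_on (\<rho> j) (R j)"
    and \<rho>: "\<And>j. j \<in> {1..L} \<Longrightarrow> \<rho> j ` R j \<subseteq> {d j..<M j}" by metis
  have dN: "d k \<le> N k" if "k \<in> {1..K}" for k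
    using Ar[OF that] by linarith
  have dM: "d j \<le> M j" if "j \<in> {1..L}" for j
    using At[OF that] by linarith

  \<comment> \<open>Unknowns are indexed by equations. Inverting the reservation puts each at its
    place; free entries without a reservation are 0.\<close>
  define w where "w x = (\<lambda>(k, a, i). if i \<in> \<pi> k ` S k
      then (case inv_into (S k) (\<pi> k) i of (j, b) \<Rightarrow> x (k, j, a, b)) else 0)"
    for x :: "nat \<times> nat \<times> nat \<times> nat \<Rightarrow> complex"
  define v where "v x = (\<lambda>(j, l, b). if l \<in> \<rho> j ` R j
      then (case inv_into (R j) (\<rho> j) l of (k, a) \<Rightarrow> x (k, j, a, b)) else 0)"
    for x :: "nat \<times> nat \<times> nat \<times> nat \<Rightarrow> complex"
  \<comment> \<open>Direct channels carry an identity block of size \<open>d k\<close>. Each aligned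
    cross channel has ones that route the reserved entries into the link; a pair in both subsets is
    assigned to the receiver side.\<close>
  define h0 :: "nat \<times> nat \<times> nat \<times> nat \<Rightarrow> complex" where
    "h0 = (\<lambda>(k, j, i, l). if k = j then of_bool (l = i \<and> i < d k)
       else if (k, j) \<in> Ar k then of_bool (l < d j \<and> i = \<pi> k (j, l))
       else if (k, j) \<in> At j then of_bool (i < d k \<and> l = \<rho> j (k, i)) else 0)"

  have w_at: "w x (k, a, \<pi> k (j, b)) = x (k, j, a, b)"
    if "k \<in> {1..K}" "(k, j) \<in> Ar k" "b < d j" for x k j a b
  proof -
    have "(j, b) \<in> S k" using that by (simp add: S_def)
    then show ?thesis using \<pi>_inj[OF that(1)] by (simp add: w_def inv_into_f_f)
  qed
  have v_at: "v x (j, \<rho> j (k, a), b) = x (k, j, a, b)"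
    if "j \<in> {1..L}" "(k, j) \<in> At j" "a < d k" for x k j a b
  proof -
    have "(k, a) \<in> R j" using that by (simp add: R_def)
    then show ?thesis using \<rho>_inj[OF that(1)] by (simp add: v_def inv_into_f_f)
  qed
  have w_bd: "norm (w x (k, a, i)) \<le> 1" if "\<And>e. norm (x e) \<le> 1" for x k a i
    using that by (auto simp: w_def split: prod.split)
  have v_bd: "norm (v x (j, l, b)) \<le> 1" if "\<And>e. norm (x e) \<le> 1" for x j l b
    using that by (auto simp: v_def split: prod.split)
  have row_bd: "norm (rx_row d (w x) k a i) \<le> 1" if "\<And>e. norm (x e) \<le> 1" for x k a i
    using w_bd[OF that] by (auto simp: rx_row_def)
  have col_bd: "norm (tx_col d (v x) j l b) \<le> 1" if "\<And>e. norm (x e) \<le> 1" for x j l b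
    using v_bd[OF that] by (auto simp: tx_col_def)
  have row_diff: "norm (rx_row d (w x) k a i - rx_row d (w y) k a i) \<le> c"
    if "\<And>e. norm (x e - y e) \<le> c" for x y c k a i
    using that order_trans[OF norm_ge_zero that] by (auto simp: rx_row_def w_def split: prod.split)
  have col_diff: "norm (tx_col d (v x) j l b - tx_col d (v y) j l b) \<le> c"
    if "\<And>e. norm (x e - y e) \<le> c" for x y c j l b
    using that order_trans[OF norm_ge_zero that] by (auto simp: tx_col_def v_def split: prod.split)

  have h0_rx: "link M N d (w x) (v x) h0 k j a b = x (k, j, a, b)"
    if kj: "k \<in> {1..K}" "j \<in> {1..L}" "k \<noteq> j" and mem: "(k, j) \<in> Ar k" and ab: "a < d k" "b < d j" for x k j a b
  proof -
    have \<pi>b: "\<pi> k (j, l) \<in> {d k..<N k}" if "l < d j" for l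
      using \<pi>[OF kj(1)] mem that by (auto simp: S_def image_subset_iff)
    \<comment> \<open>\<open>h0\<close> uses only columns \<open>l < d j\<close>, where the identity
      block of the transmitter selects \<open>l = b\<close>; what remains is the entry reserved at
      \<open>\<pi> k (j, b)\<close>.\<close>
    have "(\<Sum>l<M j. rx_row d (w x) k a i * h0 (k, j, i, l) * tx_col d (v x) j l b) =
        (\<Sum>l<M j. if l = b then (if i = \<pi> k (j, b) then rx_row d (w x) k a i else 0) else 0)" for i
      using kj mem ab by (intro sum.cong) (auto simp: h0_def tx_col_def)
    also have "\<dots> i = (if i = \<pi> k (j, b) then rx_row d (w x) k a i else 0)" for i
      using ab dM[OF kj(2)] by simp
    finally have "link M N d (w x) (v x) h0 k j a b =
        (\<Sum>i<N k. if i = \<pi> k (j, b) then rx_row d (w x) k a i else 0)" unfolding link_def by simp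
    also have "\<dots> = x (k, j, a, b)"
      using \<pi>b[OF ab(2)] w_at[OF kj(1) mem ab(2)] by (simp add: rx_row_def)
    finally show ?thesis .
  qed
  have h0_tx: "link M N d (w x) (v x) h0 k j a b = x (k, j, a, b)"
    if kj: "k \<in> {1..K}" "j \<in> {1..L}" "k \<noteq> j" and mem: "(k, j) \<notin> Ar k" "(k, j) \<in> At j"
      and ab: "a < d k" "b < d j" for x k j a b
  proof -
    have \<rho>b: "\<rho> j (k, i) \<in> {d j..<M j}" if "i < d k" for i
      using \<rho>[OF kj(2)] mem that by (auto simp: R_def image_subset_iff)
    have "(\<Sum>i<N k. rx_row d (w x) k a i * h0 (k, j, i, l) * tx_col d (v x) j l b) =
        (\<Sum>i<N k. if i = a then (if l = \<rho> j (k, a) then tx_col d (v x) j l b else 0) else 0)" for l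
      using kj mem ab by (intro sum.cong) (auto simp: h0_def rx_row_def)
    also have "\<dots> l = (if l = \<rho> j (k, a) then tx_col d (v x) j l b else 0)" for l
      using ab dN[OF kj(1)] by simp
    finally have "link M N d (w x) (v x) h0 k j a b =
        (\<Sum>l<M j. if l = \<rho> j (k, a) then tx_col d (v x) j l b else 0)"
      unfolding link_def by (subst sum.swap) simp
    also have "\<dots> = x (k, j, a, b)"
      using \<rho>b[OF ab(1)] v_at[OF kj(2) mem(2) ab(1)] by (simp add: tx_col_def)
    finally show ?thesis .
  qed
  have h0_diag: "link M N d (w x) (v x) h0 k k a b = of_bool (a = b)"
    if k: "k \<in> {1..K}" and ab: "a < d k" "b < d k" for x k a b
  proof -
    have kL: "k \<in> {1..L}" using k \<open>K \<le> L\<close> by simp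
    have "(\<Sum>l<M k. rx_row d (w x) k a i * h0 (k, k, i, l) * tx_col d (v x) k l b) =
        (\<Sum>l<M k. if l = b then of_bool (i = a \<and> a = b) else 0)" for i
      using ab by (intro sum.cong) (auto simp: h0_def tx_col_def rx_row_def)
    also have "\<dots> i = (if i = a then of_bool (a = b) else 0)" for i
      using ab dM[OF kL] by simp
    finally show ?thesis unfolding link_def using ab dN[OF k] by simp
  qed

  define B where "B = Suc (\<Sum>j\<in>{1..L}. N j + M j + d j)"
  have bounds: "N k \<le> B" "M j \<le> B" "d j \<le> B" if "k \<in> {1..L}" "j \<in> {1..L}" for k j
    using member_le_sum[OF that(1), of "\<lambda>j. N j + M j + d j"]
      member_le_sum[OF that(2), of "\<lambda>j. N j + M j + d j"] by (auto simp: B_def)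
  \<comment> \<open>Two factors \<open>B\<close> make each perturbed link at most 1/4, and the
    contraction loses a factor 2 because rows and columns both vary. The third \<open>B\<close>
    absorbs \<open>d k\<close> in the determinant estimate.\<close>
  define \<epsilon> where "\<epsilon> = 1 / (4 * real B ^ 3)"
  have "B \<ge> 1" by (simp add: B_def)
  then have B1: "real B \<ge> 1" by simp
  have \<epsilon>: "\<epsilon> > 0" using B1 by (simp add: \<epsilon>_def)
  have B\<epsilon>: "real B * (real B * \<epsilon>) \<le> 1 / 4" "real B * (real B * (real B * \<epsilon>)) = 1 / 4"
    using B1 by (auto simp: \<epsilon>_def field_simps power3_eq_cube)
  have NM: "real (N k) * real (M j) * \<epsilon> \<le> 1 / 4" if "k \<in> {1..K}" "j \<in> {1..L}" for k j
  proof -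
    have "real (N k) * real (M j) \<le> real B * real B"
      using bounds[of k j] that \<open>K \<le> L\<close> by (intro mult_mono) auto
    then have "real (N k) * real (M j) * \<epsilon> \<le> real B * real B * \<epsilon>"
      using \<epsilon> by (intro mult_right_mono) auto
    with B\<epsilon>(1) show ?thesis by (simp add: mult.assoc)
  qed
  have dNM: "real (d k) * (real (N k) * real (M k) * \<epsilon>) < 1" if "k \<in> {1..K}" for k
  proof -
    have k: "k \<in> {1..L}" using that \<open>K \<le> L\<close> by simp
    have "real (d k) * (real (N k) * real (M k) * \<epsilon>) \<le> real B * (real B * real B * \<epsilon>)"
      using bounds[OF k k] \<epsilon> by (intro mult_mono) auto
    with B\<epsilon>(2) show ?thesis by (simp add: mult.assoc)
  qed

  have "normalised_feasible K M N d A h"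
    if h: "\<And>k j i l. k \<in> {1..K} \<Longrightarrow> j \<in> {1..L} \<Longrightarrow> i < N k \<Longrightarrow> l < M j \<Longrightarrow>
        norm (h (k, j, i, l) - h0 (k, j, i, l)) < \<epsilon>" for h
  proof -
    define g where "g e = h e - h0 e" for e
    have g: "norm (g (k, j, i, l)) \<le> \<epsilon>" if "k \<in> {1..K}" "j \<in> {1..L}" "i < N k" "l < M j" for k j i l
      using h[OF that] by (simp add: g_def)
    have split: "link M N d u z h k j a b = link M N d u z h0 k j a b + link M N d u z g k j a b" for u z k j a b
      by (simp add: link_def g_def sum.distrib[symmetric] algebra_simps)
    have g_bd: "norm (link M N d (w x) (v x) g k j a b) \<le> real (N k) * real (M j) * \<epsilon>"
      if "\<And>e. norm (x e) \<le> 1" "k \<in> {1..K}" "j \<in> {1..L}" for x k j a b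
      using bilinear_form_bound[of "N k" "rx_row d (w x) k a" 1 "M j" "\<lambda>l. tx_col d (v x) j l b" 1
          "\<lambda>i l. g (k, j, i, l)" \<epsilon>] row_bd[OF that(1)] col_bd[OF that(1)] g that(2,3) \<epsilon>
      by (simp add: link_def)
    have g_diff: "norm (link M N d (w x) (v x) g k j a b - link M N d (w y) (v y) g k j a b) \<le> c / 2"
      if x: "\<And>e. norm (x e) \<le> 1" and y: "\<And>e. norm (y e) \<le> 1" and xy: "\<And>e. norm (x e - y e) \<le> c"
        and kj: "k \<in> {1..K}" "j \<in> {1..L}" for x y c k j a b
    proof -
      have c: "c \<ge> 0" using order_trans[OF norm_ge_zero xy] .
      \<comment> \<open>The difference of the bilinear expressions is split by changing first the
        row and then the column.\<close>
      let ?f = "\<lambda>p q. \<Sum>i<N k. \<Sum>l<M j. p i * g (k, j, i, l) * q l"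
      have "link M N d (w x) (v x) g k j a b - link M N d (w y) (v y) g k j a b =
        ?f (\<lambda>i. rx_row d (w x) k a i - rx_row d (w y) k a i) (\<lambda>l. tx_col d (v x) j l b) +
        ?f (\<lambda>i. rx_row d (w y) k a i) (\<lambda>l. tx_col d (v x) j l b - tx_col d (v y) j l b)"
        by (simp add: link_def sum.distrib[symmetric] sum_subtractf[symmetric] algebra_simps)
      also have "norm \<dots> \<le> real (N k) * real (M j) * (c * \<epsilon> * 1) + real (N k) * real (M j) * (1 * \<epsilon> * c)"
        using row_diff[OF xy] col_diff[OF xy] row_bd[OF y] col_bd[OF x] g kj \<epsilon> c
        by (intro norm_triangle_mono bilinear_form_bound) auto
      also have "\<dots> = 2 * c * (real (N k) * real (M j) * \<epsilon>)" by simp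
      also have "\<dots> \<le> 2 * c * (1 / 4)" using NM[OF kj] c by (intro mult_left_mono) auto
      finally show ?thesis by simp
    qed
    \<comment> \<open>At \<open>h\<close> the equations read \<open>x = T x\<close>: by linearity in
      the channel, each link is its unknown plus the link of the perturbation
      \<open>g\<close>.\<close>
    define T where "T x = (\<lambda>(k, j, a, b). if (k, j) \<in> A then - link M N d (w x) (v x) g k j a b else 0)"
      for x
    obtain x where x: "\<And>e. norm (x e) \<le> 1" and Tx: "T x = x"
    proof (rule coordinatewise_contraction_fixpoint[of T])
      fix x :: "nat \<times> nat \<times> nat \<times> nat \<Rightarrow> complex"
        and e :: "nat \<times> nat \<times> nat \<times> nat"
      assume *: "\<And>e. norm (x e) \<le> (1::real)"
      obtain k j a b where e: "e = (k, j, a, b)" by (cases e)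
      show "norm (T x e) \<le> 1"
      proof (cases "(k, j) \<in> A")
        case True
        then show ?thesis using g_bd[of x k j a b, OF *] NM[of k j] inA[OF True] by (simp add: T_def e)
      qed (simp add: T_def e)
    next
      fix x y :: "nat \<times> nat \<times> nat \<times> nat \<Rightarrow> complex" and c
        and e :: "nat \<times> nat \<times> nat \<times> nat"
      assume *: "\<And>e. norm (x e) \<le> (1::real)" "\<And>e. norm (y e) \<le> (1::real)" "\<And>e. norm (x e - y e) \<le> c"
      obtain k j a b where e: "e = (k, j, a, b)" by (cases e)
      show "norm (T x e - T y e) \<le> c / 2"
      proof (cases "(k, j) \<in> A")
        case True
        then show ?thesis using g_diff[of x y c k j a b, OF *] inA[OF True]
          by (simp add: T_def e norm_minus_commute)
      next
        case False
        then show ?thesis using order_trans[OF norm_ge_zero *(3)] by (simp add: T_def e)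
      qed
    qed blast
    have "link M N d (w x) (v x) h k j a b = 0" if "(k, j) \<in> A" "a < d k" "b < d j" for k j a b
    proof -
      note kj = inA[OF that(1)]
      \<comment> \<open>The shape of the alignment subsets forces the index of the one containing
        the pair to be \<open>k\<close> or \<open>j\<close>.\<close>
      have "(k, j) \<in> Ar k \<or> (k, j) \<in> At j"
      proof -
        from that(1) consider k' where "k' \<in> {1..K}" "(k, j) \<in> Ar k'"
          | j' where "j' \<in> {1..L}" "(k, j) \<in> At j'" unfolding Aeq by blast
        then show ?thesis
        proof cases
          case 1
          with Ar[OF 1(1)] show ?thesis by blast
        next
          case 2
          with At[OF 2(1)] show ?thesis by blast
        qed
      qed
      then have "link M N d (w x) (v x) h0 k j a b = x (k, j, a, b)"
        using h0_rx[OF kj _ that(2,3)] h0_tx[OF kj _ _ that(2,3)] by blast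
      moreover have "x (k, j, a, b) = - link M N d (w x) (v x) g k j a b"
        using fun_cong[OF Tx, of "(k, j, a, b)"] that(1) by (simp add: T_def)
      ultimately show ?thesis by (simp add: split)
    qed
    moreover have "det (mat (d k) (d k) (\<lambda>(a, b). link M N d (w x) (v x) h k k a b)) \<noteq> 0"
      if k: "k \<in> {1..K}" for k
    proof -
      have kL: "k \<in> {1..L}" using k \<open>K \<le> L\<close> by simp
      \<comment> \<open>The direct links at \<open>h0\<close> form the identity matrix, so only the
        perturbation has to be controlled.\<close>
      have "mat (d k) (d k) (\<lambda>(a, b). link M N d (w x) (v x) h k k a b) =
          mat (d k) (d k) (\<lambda>(a, b). of_bool (a = b) + link M N d (w x) (v x) g k k a b)"
        by (intro cong_mat) (auto simp: split h0_diag[OF k])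
      moreover have "det \<dots> \<noteq> 0"
        by (rule det_nonzero_near_identity[OF g_bd[of x, OF x k kL] dNM[OF k]])
      ultimately show ?thesis by simp
    qed
    ultimately show ?thesis unfolding normalised_feasible_def by blast
  qed
  with \<epsilon> show ?thesis using that by blast
qed

section \<open>Almost sure independence of the channel entries, and feasibility\<close>

theorem theorem3p1:
  fixes P :: "'w measure"
    and K J :: nat
    and M N d :: "nat \<Rightarrow> nat"
    and H :: "nat \<Rightarrow> nat \<Rightarrow> 'w \<Rightarrow> complex mat"
    and A :: "(nat \<times> nat) set"
    and Ar At :: "nat \<Rightarrow> (nat \<times> nat) set"
  assumes "prob_space P"
    and "K \<ge> 1"
    and "\<And>j. j \<in> {1..K+J} \<Longrightarrow> M j > 0 \<and> d j > 0"
    and "\<And>k. k \<in> {1..K} \<Longrightarrow> N k > 0"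
    and "\<And>k j \<omega>. k \<in> {1..K} \<Longrightarrow> j \<in> {1..K+J} \<Longrightarrow> \<omega> \<in> space P \<Longrightarrow>
           H k j \<omega> \<in> carrier_mat (N k) (M j)"
    and "prob_space.indep_vars P (\<lambda>_. borel :: complex measure)
           (\<lambda>(k, j, a, b) \<omega>. H k j \<omega> $$ (a, b))
           {(k, j, a, b). k \<in> {1..K} \<and> j \<in> {1..K+J} \<and> a < N k \<and> b < M j}"
    and "\<And>k j a b. k \<in> {1..K} \<Longrightarrow> j \<in> {1..K+J} \<Longrightarrow> a < N k \<Longrightarrow> b < M j \<Longrightarrow>
           continuous_distribution (distr P borel (\<lambda>\<omega>. H k j \<omega> $$ (a, b)))"
    and "A \<subseteq> {(k, j). k \<in> {1..K} \<and> j \<in> {1..K+J} \<and> k \<noteq> j}"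
    and "\<And>k. k \<in> {1..K} \<Longrightarrow> proper_rx_subset K J N d k (Ar k)"
    and "\<And>j. j \<in> {1..K+J} \<Longrightarrow> proper_tx_subset K M d j (At j)"
    and "A = (\<Union>k\<in>{1..K}. Ar k) \<union> (\<Union>j\<in>{1..K+J}. At j)"
  shows "AE \<omega> in P. gia_feasible K J M N d (\<lambda>k j. H k j \<omega>) A"
proof -
  define I where "I = {(k, j, a, b). k \<in> {1..K} \<and> j \<in> {1..K+J} \<and> a < N k \<and> b < M j}"
  define X where "X = (\<lambda>(k, j, a, b) \<omega>. H k j \<omega> $$ (a, b))"
  interpret prob_space P by fact
  have A: "A \<subseteq> {1..K} \<times> {1..K+J}" using assms(8) by blast
  have "I = (SIGMA k:{1..K}. SIGMA j:{1..K+J}. {..<N k} \<times> {..<M j})" unfolding I_def by auto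
  then have finI: "finite I" by simp
  \<comment> \<open>The characterisation of independence by the product law is applied to a nonempty
    index set; the positivity assumptions supply an element.\<close>
  have "(1, 1, 0, 0) \<in> I" using assms(2) assms(3)[of 1] assms(4)[of 1] by (simp add: I_def)
  then have "I \<noteq> {}" by blast
  have indep: "indep_vars (\<lambda>_. borel :: complex measure) X I"
    using assms(6) unfolding X_def I_def .
  then have rv: "random_variable borel (X i)" if "i \<in> I" for i
    using that unfolding indep_vars_def by blast
  \<comment> \<open>Independence turns the joint law into the product of the atomless
    marginals.\<close>
  have "distr P (\<Pi>\<^sub>M i\<in>I. borel) (\<lambda>\<omega>. \<lambda>i\<in>I. X i \<omega>) = (\<Pi>\<^sub>M i\<in>I. distr P borel (X i))"
    using indep_vars_iff_distr_eq_PiM'[OF \<open>I \<noteq> {}\<close>, where M' = "\<lambda>_. borel" and X = X] rv indep by blast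
  moreover have "AE h in (\<Pi>\<^sub>M i\<in>I. distr P borel (X i)). alg_indep I h"
  proof (rule AE_PiM_alg_indep)
    fix i assume "i \<in> I"
    then show "prob_space (distr P borel (X i))" using rv by (intro prob_space_distr)
    obtain k j a b where "i = (k, j, a, b)" by (cases i)
    with \<open>i \<in> I\<close> show "continuous_distribution (distr P borel (X i))"
      using assms(7)[of k j a b] by (simp add: I_def X_def)
  qed (use finI in auto)
  ultimately have "AE h in distr P (\<Pi>\<^sub>M i\<in>I. borel) (\<lambda>\<omega>. \<lambda>i\<in>I. X i \<omega>). alg_indep I h" by metis
  then have "AE \<omega> in P. alg_indep I (\<lambda>i\<in>I. X i \<omega>)"
    by (rule AE_distrD[rotated]) (intro measurable_restrict rv)
  moreover have "alg_indep I (\<lambda>i\<in>I. X i \<omega>) \<longleftrightarrow> alg_indep I (\<lambda>(k, j, a, b). H k j \<omega> $$ (a, b))" for \<omega>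
    by (rule alg_indep_cong) (auto simp: X_def)
  ultimately have generic: "AE \<omega> in P. alg_indep I (\<lambda>(k, j, a, b). H k j \<omega> $$ (a, b))" by simp

  have Ar: "Ar k \<subseteq> {k} \<times> UNIV \<and> int (\<Sum>j | (k, j) \<in> Ar k. d j) \<le> int (N k) - int (d k)"
    if "k \<in> {1..K}" for k
    using assms(9)[OF that] unfolding proper_rx_subset_def by blast
  have At: "At j \<subseteq> UNIV \<times> {j} \<and> int (\<Sum>k | (k, j) \<in> At j. d k) \<le> int (M j) - int (d j)"
    if "j \<in> {1..K+J}" for j
    using assms(10)[OF that] unfolding proper_tx_subset_def by blast
  have "K \<le> K + J" by simp
  obtain h0 \<epsilon> where \<epsilon>: "\<epsilon> > 0" and near: "\<And>h. (\<And>k j i l. k \<in> {1..K} \<Longrightarrow> j \<in> {1..K+J} \<Longrightarrow> i < N k \<Longrightarrow>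
      l < M j \<Longrightarrow> norm (h (k, j, i, l) - h0 (k, j, i, l)) < \<epsilon>) \<Longrightarrow> normalised_feasible K M N d A h"
    by (rule normalised_feasible_near[OF assms(8) \<open>K \<le> K + J\<close> assms(11) Ar At]) blast+
  \<comment> \<open>One generic feasible channel suffices: its solution transfers to almost every
    realisation.\<close>
  obtain h' where h': "alg_indep I h'" "\<And>i. i \<in> I \<Longrightarrow> norm (h' i - h0 i) < \<epsilon>"
    using exists_alg_indep_near[OF finI \<epsilon>, of h0] by blast
  have feas': "normalised_feasible K M N d A h'"
    by (rule near) (simp add: h'(2) I_def)
  have dM: "d j \<le> M j" if "j \<in> {1..K+J}" for j
    using At[OF that] by linarith
  from generic show ?thesis
  proof (rule AE_mp, intro AE_I2 impI)
    fix \<omega> assume "\<omega> \<in> space P" and gen: "alg_indep I (\<lambda>(k, j, a, b). H k j \<omega> $$ (a, b))"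
    have "normalised_feasible K M N d A (\<lambda>(k, j, a, b). H k j \<omega> $$ (a, b))"
      by (rule normalised_feasible_transfer[OF feas' A _ I_def h'(1) gen]) simp
    then show "gia_feasible K J M N d (\<lambda>k j. H k j \<omega>) A"
      by (rule gia_feasible_if_normalised[OF _ A]) (use assms(5) \<open>\<omega> \<in> space P\<close> dM in auto)
  qed
qed

end
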